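(* For any $\epsilon > 0$ there is $n_0$ such that for every integer $n\ge n_0$ there is a tree $T$ of order $n$ (i.e. with $n$ vertices) such that $h(T) \ge (1/4 - \epsilon) \log_2(n)$.
   Context: The game: on a finite graph $G$, an invisible mouse and a team of $r$ cats ($r \ge 0$) play as follows. In round $i=1,2,\dots$ the mouse is at some vertex $v_i$, where $v_1$ is arbitrary and for $i\ge 2$ the vertex $v_i$ must be adjacent to $v_{i-1}$ (the mouse must move at every turn). Then each cat chooses any vertex of $G$ (cats are not constrained to move along edges); the mouse is caught in round $i$ if some cat chooses $v_i$. The cats never see the mouse, so a strategy for $r$ cats is a sequence $C_1,C_2,\dots$ of subsets of $V(G)$, each of size at most $r$, and the mouse evades it indefinitely if there is an infinite sequence of vertices $v_1,v_2,\dots$ with $v_i$ adjacent to $v_{i+1}$ and $v_i\notin C_i$ for all $i\ge 1$. The graph $G$ is an $r$-cat-win if some strategy for $r$ cats cannot be evaded indefinitely (equivalently, for finite $G$: there is a finite sequence $C_1,\dots,C_t$ of sets of size at most $r$ such that every walk $v_1,\dots,v_t$ in $G$ has $v_i\in C_i$ for some $i$); otherwise $G$ is an $r$-mouse-win. $h(G)$ denotes the least integer $r$ such that $G$ is an $r$-cat-win. *)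

theory Defs
  imports Complex_Main "Graph_Theory.Digraph_Component"
begin

text \<open>
  Graphs are symmetric digraphs: \<^const>\<open>pair_graph\<close> is a finite simple graph, each undirected edge
  being represented by its two arcs.  The library's \<^const>\<open>Digraph_Component.tree\<close> cannot be used
  for such graphs, because it counts the closed walk \<open>a, b, a\<close> along a single edge as a cycle.
  A cycle of an undirected simple graph is a \<^const>\<open>pre_digraph.cycle\<close> of length at least 3.
\<close>

definition undirected_tree :: "'a pair_pre_digraph \<Rightarrow> bool" where
  "undirected_tree G \<longleftrightarrow>
     pair_graph G \<and> Digraph_Component.connected (with_proj G) \<and>
     \<not> (\<exists>p. pre_digraph.cycle (with_proj G) p \<and> 3 \<le> length p)"

text \<open>Rounds are numbered from 0, so index \<open>i\<close> stands for round \<open>i + 1\<close> of the game.\<close>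

definition cat_strategy :: "'a pair_pre_digraph \<Rightarrow> nat \<Rightarrow> (nat \<Rightarrow> 'a set) \<Rightarrow> bool" where
  "cat_strategy G r C \<longleftrightarrow> (\<forall>i. C i \<subseteq> pverts G \<and> finite (C i) \<and> card (C i) \<le> r)"

definition mouse_evades :: "'a pair_pre_digraph \<Rightarrow> (nat \<Rightarrow> 'a set) \<Rightarrow> (nat \<Rightarrow> 'a) \<Rightarrow> bool" where
  "mouse_evades G C v \<longleftrightarrow>
     (\<forall>i. v i \<in> pverts G \<and> (v i, v (Suc i)) \<in> parcs G \<and> v i \<notin> C i)"

definition cat_win :: "'a pair_pre_digraph \<Rightarrow> nat \<Rightarrow> bool" where
  "cat_win G r \<longleftrightarrow> (\<exists>C. cat_strategy G r C \<and> \<not> (\<exists>v. mouse_evades G C v))"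

definition cat_number :: "'a pair_pre_digraph \<Rightarrow> nat" where
  "cat_number G = (LEAST r. cat_win G r)"

text \<open>The least number exists for finite graphs: occupying every vertex wins.\<close>

lemma cat_win_card_pverts:
  assumes "finite (pverts G)"
  shows "cat_win G (card (pverts G))"
  unfolding cat_win_def cat_strategy_def mouse_evades_def
  using assms by (intro exI[of _ "\<lambda>_. pverts G"]) simp

lemma cat_win_cat_number:
  assumes "finite (pverts G)"
  shows "cat_win G (cat_number G)"
  unfolding cat_number_def by (rule LeastI) (rule cat_win_card_pverts[OF assms])

end

theory Submission
  imports Defs
begin

text \<open>
  Let \<open>H\<close> be the complete ternary tree with levels \<open>0, \<dots>, d\<close>, and let \<open>T\<close> be \<open>H\<close> with a pendant leaf
  hung on every vertex (and further leaves on the root, to reach the order \<open>n\<close>).  The leaves let the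
  mouse wait: it can stay at a vertex of \<open>H\<close> by stepping to the leaf and back.  Restrict the mouse to
  starting vertices of one colour class of \<open>T\<close>.  In every round the vertices of \<open>H\<close> of one parity are
  active, meaning that the set of possible positions spreads from them to their neighbours, while
  \<open>k\<close> cats remove at most \<open>k\<close> positions.  So if every \<open>W\<close> in \<open>H\<close> of about half the size of \<open>H\<close> has
  at least \<open>2 * k\<close> vertices in its outer boundary, then the set of possible positions never drops
  below half, and an evading walk exists by compactness.

  For the boundary, let \<open>x j\<close> count the vertices of level \<open>j\<close> lying in \<open>W\<close> or having their parent in
  \<open>W\<close>.  Then \<open>x (Suc j) = 3 * x j + t j\<close> with \<open>\<bar>t j\<bar>\<close> at most three times the number of boundary
  vertices on level \<open>j\<close>.  The numbers \<open>e j = 2 * x j - 3 ^ j\<close> are odd, hence nonzero, and satisfy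
  \<open>e (Suc j) = 3 * e j + 2 * t j\<close>: they would triple at each level if there were no boundary, whereas
  \<open>e d\<close> is small because \<open>W\<close> contains half of \<open>H\<close>.  This forces a boundary of size about \<open>d\<close>.
\<close>

section \<open>Trees given by a parent function\<close>

definition parent_graph :: "(nat \<Rightarrow> nat) \<Rightarrow> nat \<Rightarrow> nat pair_pre_digraph" where
  "parent_graph p n = \<lparr>pverts = {..<n},
     parcs = {(u, v). (0 < u \<and> u < n \<and> v = p u) \<or> (0 < v \<and> v < n \<and> u = p v)}\<rparr>"

lemma parent_graph_simps [simp]:
  "pverts (parent_graph p n) = {..<n}"
  "(u, v) \<in> parcs (parent_graph p n) \<longleftrightarrow>
     (0 < u \<and> u < n \<and> v = p u) \<or> (0 < v \<and> v < n \<and> u = p v)"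
  by (simp_all add: parent_graph_def)

lemma pair_graph_parent_graph:
  assumes "\<And>v. 0 < v \<Longrightarrow> v < n \<Longrightarrow> p v < v"
  shows "pair_graph (parent_graph p n)"
proof -
  have arcs: "u < n" "v < n" "u \<noteq> v" if "(u, v) \<in> parcs (parent_graph p n)" for u v
    by (use that assms[of u] assms[of v] in force)+
  have "parcs (parent_graph p n) \<subseteq> {..<n} \<times> {..<n}"
    using arcs by (auto simp del: parent_graph_simps(2))
  then have "finite (parcs (parent_graph p n))"
    by (rule finite_subset) simp
  moreover have "symmetric (with_proj (parent_graph p n))"
    unfolding symmetric_def by (rule symI) (simp, blast)
  ultimately show ?thesis
    by unfold_locales (force dest: arcs simp del: parent_graph_simps(2))+
qed

lemma connected_parent_graph:
  assumes "\<And>v. 0 < v \<Longrightarrow> v < n \<Longrightarrow> p v < v" and "0 < n"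
  shows "Digraph_Component.connected (with_proj (parent_graph p n))"
proof -
  let ?G = "parent_graph p n"
  interpret pair_graph ?G
    using assms(1) by (rule pair_graph_parent_graph)
  have to_root: "v \<rightarrow>\<^sup>*\<^bsub>with_proj ?G\<^esub> 0" if "v < n" for v
    using that
  proof (induction v rule: less_induct)
    case (less v)
    show ?case
    proof (cases "v = 0")
      case True
      then show ?thesis using less.prems by simp
    next
      case False
      then have "p v \<rightarrow>\<^sup>*\<^bsub>with_proj ?G\<^esub> 0"
        using less assms(1)[of v] by simp
      moreover have "(v, p v) \<in> parcs ?G"
        using False less.prems by simp
      ultimately show ?thesis
        by (intro adj_reachable_trans[of v "p v" 0])
    qed
  qed
  have "u \<rightarrow>\<^sup>*\<^bsub>mk_symmetric (with_proj ?G)\<^esub> v" if "u < n" "v < n" for u v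
  proof -
    have "u \<rightarrow>\<^sup>*\<^bsub>with_proj ?G\<^esub> 0" "0 \<rightarrow>\<^sup>*\<^bsub>with_proj ?G\<^esub> v"
      using to_root[OF that(1)] symmetric_reachable'[OF to_root[OF that(2)]] by simp_all
    then have "u \<rightarrow>\<^sup>*\<^bsub>with_proj ?G\<^esub> v"
      by (rule reachable_trans)
    then show ?thesis
      by (rule reachable_mk_symmetricI)
  qed
  then show ?thesis
    using assms(2) unfolding connected_def strongly_connected_def by auto
qed

lemma pcas_nth:
  assumes "pcas u p v" "Suc i < length p"
  shows "snd (p ! i) = fst (p ! Suc i)"
  using assms
proof (induction p arbitrary: u i)
  case (Cons e p)
  then show ?case
    by (cases i; cases p) auto
qed simp

lemma pcas_last:
  assumes "pcas u p v" "p \<noteq> []"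
  shows "snd (last p) = v" "fst (hd p) = u"
  using assms by (induction p arbitrary: u) auto

lemma acyclic_parent_graph:
  assumes p: "\<And>v. 0 < v \<Longrightarrow> v < n \<Longrightarrow> p v < v"
    and cyc: "pre_digraph.cycle (with_proj (parent_graph p n)) c"
  shows "length c < 3"
proof (rule ccontr)
  assume "\<not> length c < 3"
  then have L: "3 \<le> length c" by simp
  let ?G = "parent_graph p n" and ?L = "length c"
  interpret pair_graph ?G
    using p by (rule pair_graph_parent_graph)
  obtain u where walk: "awalk u c u" and dist: "distinct (tl (pawalk_verts u c))"
    using cyc unfolding cycle_def by auto
  have cas: "pcas u c u" and arcs: "set c \<subseteq> parcs ?G"
    using walk unfolding awalk_def by auto
  have ne: "c \<noteq> []" using L by auto
  have "distinct (map snd c)"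
    using dist awalk_verts_conv'[OF cas] ne by simp
  then have inj: "i = j" if "i < ?L" "j < ?L" "snd (c ! i) = snd (c ! j)" for i j
    using that nth_eq_iff_index_eq[of "map snd c" i j] by simp
  have next_arc: "fst (c ! (Suc i mod ?L)) = snd (c ! i)" if "i < ?L" for i
  proof (cases "Suc i < ?L")
    case True
    then show ?thesis using pcas_nth[OF cas] by simp
  next
    case False
    then have "Suc i = ?L" using that by simp
    then show ?thesis
      using pcas_last[OF cas ne] ne
      by (metis diff_Suc_1 hd_conv_nth last_conv_nth mod_self)
  qed
  \<comment> \<open>Both cyclic neighbours of the largest vertex of a cycle are its parent.\<close>
  define M where "M = Max ((\<lambda>i. snd (c ! i)) ` {..<?L})"
  have "M \<in> (\<lambda>i. snd (c ! i)) ` {..<?L}"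
    unfolding M_def using L by (intro Max_in) (auto simp: lessThan_empty_iff)
  then obtain i where i: "i < ?L" "snd (c ! i) = M" by auto
  have maxi: "snd (c ! j) \<le> M" if "j < ?L" for j
    unfolding M_def using that by (intro Max_ge) auto
  have towards_parent: "v = p M" if "(M, v) \<in> parcs ?G \<or> (v, M) \<in> parcs ?G" "v \<le> M" for v
    using that p[of v] by force
  define j where "j = (if i = 0 then ?L - 1 else i - 1)"
  have j: "j < ?L" "Suc j mod ?L = i"
    using i L by (auto simp: j_def)
  have "c ! i \<in> parcs ?G" using i arcs by auto
  moreover have "c ! i = (snd (c ! j), M)"
    using next_arc[OF j(1)] j(2) i(2) by (simp add: prod_eq_iff)
  ultimately have pred: "snd (c ! j) = p M"
    using maxi[OF j(1)] by (intro towards_parent) (simp_all del: parent_graph_simps)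
  define k where "k = Suc i mod ?L"
  have k: "k < ?L" using ne unfolding k_def by (intro mod_less_divisor) simp
  have "c ! k \<in> parcs ?G" using k arcs by auto
  moreover have "c ! k = (M, snd (c ! k))"
    using next_arc[OF i(1)] i(2) by (simp add: k_def prod_eq_iff)
  ultimately have "snd (c ! k) = p M"
    using maxi[OF k] by (intro towards_parent) (simp_all del: parent_graph_simps)
  \<comment> \<open>Arc heads on the cycle are distinct, so equal heads force equal positions; but
    \<open>j\<close> and \<open>k\<close> are the cyclic predecessor and successor of
    \<open>i\<close>, which differ once \<open>?L\<close> is at least 3.\<close>
  then have "j = k" using inj[OF j(1) k] pred by simp
  then show False
  proof (cases "Suc i = ?L")
    case True
    then show False using \<open>j = k\<close> L by (auto simp: j_def k_def split: if_splits)
  next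
    case False
    then have "Suc i < ?L" using i by simp
    then show False using \<open>j = k\<close> L by (auto simp: j_def k_def split: if_splits)
  qed
qed

lemma undirected_tree_parent_graph:
  assumes "\<And>v. 0 < v \<Longrightarrow> v < n \<Longrightarrow> p v < v" and "0 < n"
  shows "undirected_tree (parent_graph p n)"
  unfolding undirected_tree_def
  using pair_graph_parent_graph[OF assms(1)] connected_parent_graph[OF assms]
    acyclic_parent_graph[OF assms(1)] by (auto simp: not_le)

section \<open>Evasion on finite graphs\<close>

lemma cat_win_mono:
  assumes "cat_win G r" "r \<le> s"
  shows "cat_win G s"
  using assms unfolding cat_win_def cat_strategy_def by (meson le_trans)

lemma less_cat_number:
  assumes "finite (pverts G)" "\<not> cat_win G r"
  shows "r < cat_number G"
  using assms cat_win_cat_number cat_win_mono not_le by blast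

text \<open>From \<open>x\<close> in round \<open>t\<close>, the mouse can avoid the cats up to and including round \<open>t + s\<close>.\<close>

primrec survives :: "'a pair_pre_digraph \<Rightarrow> (nat \<Rightarrow> 'a set) \<Rightarrow> nat \<Rightarrow> nat \<Rightarrow> 'a \<Rightarrow> bool" where
  "survives G C 0 t x \<longleftrightarrow> x \<in> pverts G \<and> x \<notin> C t"
| "survives G C (Suc s) t x \<longleftrightarrow> x \<in> pverts G \<and> x \<notin> C t \<and>
     (\<exists>y. (x, y) \<in> parcs G \<and> survives G C s (Suc t) y)"

lemma survives_in_pverts: "survives G C s t x \<Longrightarrow> x \<in> pverts G \<and> x \<notin> C t"
  by (cases s) auto

lemma survives_antimono:
  "survives G C s t x \<Longrightarrow> s' \<le> s \<Longrightarrow> survives G C s' t x"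
proof (induction s arbitrary: s' t x)
  case (Suc s)
  then show ?case by (cases s') auto
qed simp

text \<open>This is the compactness step: if each candidate failed at some horizon, the maximum of
  these finitely many horizons would defeat all of them, as survival is antitone in the
  horizon.\<close>

lemma survives_forever_pigeonhole:
  assumes "finite (pverts G)" "\<And>s. \<exists>x. P x \<and> survives G C s t x"
  shows "\<exists>x. P x \<and> (\<forall>s. survives G C s t x)"
proof (rule ccontr)
  assume "\<not> ?thesis"
  then have "\<forall>x. \<exists>s. P x \<longrightarrow> \<not> survives G C s t x" by blast
  then obtain f where f: "\<And>x. P x \<Longrightarrow> \<not> survives G C (f x) t x" by metis
  obtain x where x: "P x" "survives G C (Max (f ` pverts G)) t x"
    using assms(2) by blast
  then have "f x \<le> Max (f ` pverts G)"
    using assms(1) survives_in_pverts[OF x(2)] by (intro Max_ge) auto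
  with x f survives_antimono show False by metis
qed

lemma mouse_evades_if_survives:
  assumes "finite (pverts G)" "\<And>s. \<exists>x. survives G C s 0 x"
  shows "\<exists>v. mouse_evades G C v"
proof -
  define good where "good t x \<longleftrightarrow> (\<forall>s. survives G C s t x)" for t x
  have "\<exists>x. good 0 x"
    using survives_forever_pigeonhole[of G "\<lambda>_. True"] assms by (auto simp: good_def)
  moreover have "\<exists>y. good (Suc t) y \<and> (x, y) \<in> parcs G" if "good t x" for t x
  proof -
    have "\<exists>y. (x, y) \<in> parcs G \<and> survives G C s (Suc t) y" for s
      using that[unfolded good_def, rule_format, of "Suc s"] by auto
    then show ?thesis
      using survives_forever_pigeonhole[of G "\<lambda>y. (x, y) \<in> parcs G" C "Suc t"] assms(1)
      unfolding good_def by blast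
  qed
  ultimately obtain v where v: "\<And>t. good t (v t)" "\<And>t. (v t, v (Suc t)) \<in> parcs G"
    using dependent_nat_choice[of good "\<lambda>t x y. (x, y) \<in> parcs G"] by metis
  have "v t \<in> pverts G \<and> v t \<notin> C t" for t
    using v(1)[unfolded good_def, rule_format] by (rule survives_in_pverts)
  with v(2) show ?thesis
    unfolding mouse_evades_def by blast
qed

text \<open>Tracing a point of \<open>R s\<close> back through \<open>step\<close> to round 0 gives
  safe walks of every finite length; compactness turns them into an infinite one.\<close>

lemma mouse_evades_if_reachable_sets:
  assumes fin: "finite (pverts G)"
    and safe: "\<And>t x. x \<in> R t \<Longrightarrow> x \<in> pverts G \<and> x \<notin> C t"
    and step: "\<And>t y. y \<in> R (Suc t) \<Longrightarrow> \<exists>x\<in>R t. (x, y) \<in> parcs G"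
    and nonempty: "\<And>t. R t \<noteq> {}"
  shows "\<exists>v. mouse_evades G C v"
proof (rule mouse_evades_if_survives[OF fin])
  have extend: "\<exists>z. survives G C (t + s) 0 z" if "x \<in> R t" "survives G C s t x" for t s x
    using that
  proof (induction t arbitrary: s x)
    case (Suc t)
    then obtain y where "y \<in> R t" "(y, x) \<in> parcs G"
      using step by blast
    with Suc safe have "survives G C (Suc s) t y" by auto
    with Suc.IH[OF \<open>y \<in> R t\<close>] show ?case by fastforce
  qed auto
  show "\<exists>x. survives G C s 0 x" for s
  proof -
    obtain x where "x \<in> R s" using nonempty[of s] by blast
    with extend[of x s 0] safe show ?thesis by auto
  qed
qed

section \<open>The vertex boundary in the ternary tree\<close>

text \<open>The infinite ternary tree on the natural numbers in heap order: the root is 0, and the children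
  of \<open>v\<close> are \<open>3 * v + 1\<close>, \<open>3 * v + 2\<close>, \<open>3 * v + 3\<close>.\<close>

fun lev :: "nat \<Rightarrow> nat" where
  "lev 0 = 0"
| "lev (Suc v) = Suc (lev (v div 3))"

text \<open>Truncated subtraction makes \<open>par 0 = 0\<close>; the guards \<open>0 < v\<close>
  below keep the root from being its own child.\<close>

definition par :: "nat \<Rightarrow> nat" where
  "par v = (v - 1) div 3"

text \<open>The levels \<open>0, \<dots>, d - 1\<close> are exactly the numbers below \<open>heap_size d\<close>.\<close>

primrec heap_size :: "nat \<Rightarrow> nat" where
  "heap_size 0 = 0"
| "heap_size (Suc d) = 3 * heap_size d + 1"

lemma heap_size_eq: "2 * heap_size d + 1 = 3 ^ d"
  by (induction d) auto

lemma par_less: "0 < v \<Longrightarrow> par v < v"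
  unfolding par_def by linarith

lemma lev_par: "0 < v \<Longrightarrow> lev v = Suc (lev (par v))"
  by (cases v) (simp_all add: par_def)

lemma lev_eq_Suc_iff: "lev v = Suc j \<longleftrightarrow> 0 < v \<and> lev (par v) = j"
  by (cases v) (simp_all add: par_def)

lemma lev_eq_0_iff: "lev v = 0 \<longleftrightarrow> v = 0"
  by (cases v) simp_all

lemma less_heap_size_iff: "v < heap_size d \<longleftrightarrow> lev v < d"
proof (induction d arbitrary: v)
  case (Suc d)
  show ?case
  proof (cases v)
    case (Suc w)
    have "w div 3 < heap_size d \<longleftrightarrow> w < 3 * heap_size d"
      by (simp add: div_less_iff_less_mult mult.commute)
    then show ?thesis
      using Suc.IH[of "w div 3"] Suc by simp
  qed simp
qed simp

lemma finite_level: "finite {v. lev v = j}"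
  by (rule finite_subset[of _ "{..<heap_size (Suc j)}"]) (auto simp: less_heap_size_iff simp del: heap_size.simps)

lemma card_eq_sum_levels:
  assumes "S \<subseteq> {..<heap_size (Suc d)}"
  shows "card S = (\<Sum>j\<le>d. card {v \<in> S. lev v = j})"
proof -
  have "finite S"
    using assms finite_subset by blast
  moreover have "lev ` S \<subseteq> {..d}"
    using assms by (auto simp: less_heap_size_iff simp del: heap_size.simps)
  ultimately show ?thesis
    using sum.group[of S "{..d}" lev "\<lambda>_. 1 :: nat"] by simp
qed

definition children :: "nat set \<Rightarrow> nat set" where
  "children S = {v. 0 < v \<and> par v \<in> S}"

lemma children_eq: "children S = (\<Union>v\<in>S. {3 * v + 1, 3 * v + 2, 3 * v + 3})"
proof (rule set_eqI)
  fix u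
  have child: "0 < u \<and> par u = v \<longleftrightarrow> u \<in> {3 * v + 1, 3 * v + 2, 3 * v + 3}" for v
    unfolding par_def insert_iff empty_iff by presburger
  have "u \<in> children S \<longleftrightarrow> (\<exists>v\<in>S. 0 < u \<and> par u = v)"
    by (auto simp: children_def)
  then show "u \<in> children S \<longleftrightarrow> u \<in> (\<Union>v\<in>S. {3 * v + 1, 3 * v + 2, 3 * v + 3})"
    by (simp only: child UN_iff)
qed

lemma card_children:
  assumes "finite S"
  shows "card (children S) = 3 * card S"
  unfolding children_eq using assms
  by (subst card_UN_disjoint) auto

lemma finite_children: "finite S \<Longrightarrow> finite (children S)"
  unfolding children_eq by auto

definition adj :: "nat \<Rightarrow> nat \<Rightarrow> bool" where
  "adj u v \<longleftrightarrow> (0 < u \<and> v = par u) \<or> (0 < v \<and> u = par v)"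

definition boundary :: "nat \<Rightarrow> nat set \<Rightarrow> nat set" where
  "boundary N W = {v. v < N \<and> v \<notin> W \<and> (\<exists>u\<in>W. adj u v)}"

text \<open>Oddness is essential: the cases \<open>b = 1\<close> and \<open>b = 2\<close> fail for even \<open>e\<close> and small \<open>e'\<close>.\<close>

lemma odd_step:
  fixes e e' t :: int
  assumes "odd e" and e': "e' = 3 * e + 2 * t" and t: "\<bar>t\<bar> \<le> 3 * int b"
  shows "3 * \<bar>e\<bar> \<le> 3 ^ b * \<bar>e'\<bar>"
proof -
  have "odd e'" using assms(1) e' by simp
  then have e'1: "1 \<le> \<bar>e'\<bar>" by (cases "e' = 0") auto
  have bound: "3 * \<bar>e\<bar> \<le> \<bar>e'\<bar> + 6 * int b"
    using e' t by linarith
  consider "b = 0" | "b = 1" | "b = 2" | "3 \<le> b" by linarith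
  then show ?thesis
  proof cases
    case 1
    then show ?thesis using bound by simp
  next
    case 2
    have "\<bar>e\<bar> \<noteq> 2" "\<bar>e'\<bar> \<noteq> 2" using assms(1) \<open>odd e'\<close>
      by (metis even_numeral dvd_abs_iff)+
    then have "\<bar>e\<bar> \<le> \<bar>e'\<bar>" using bound e'1 2 by linarith
    then show ?thesis using 2 by simp
  next
    case 3
    have "\<bar>e\<bar> \<noteq> 4" using assms(1) by (metis even_numeral dvd_abs_iff)
    then have "\<bar>e\<bar> \<le> 3 * \<bar>e'\<bar>" using bound e'1 3 by linarith
    then show ?thesis using 3 by simp
  next
    case 4
    have "6 * int b \<le> 3 ^ b - 1"
      using 4
    proof (induction b rule: dec_induct)
      case (step n)
      then show ?case by simp
    qed simp
    moreover have "3 ^ b - 1 \<le> (3 ^ b - 1) * \<bar>e'\<bar>"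
      using e'1 mult_left_mono[of 1 "\<bar>e'\<bar>" "3 ^ b - 1"] by simp
    ultimately show ?thesis
      using bound unfolding left_diff_distrib by linarith
  qed
qed

text \<open>The first conclusion iterates \<open>odd_step\<close> on \<open>2 * x j - 3 ^ j\<close>,
  which starts at 1 or -1. The second links \<open>x d\<close> to the total of \<open>x\<close>, so
  that the size of a set can control its last level.\<close>

lemma tripling_recurrence:
  fixes x t :: "nat \<Rightarrow> int" and b :: "nat \<Rightarrow> nat"
  assumes rec: "\<And>j. j < d \<Longrightarrow> x (Suc j) = 3 * x j + t j"
    and t: "\<And>j. j < d \<Longrightarrow> \<bar>t j\<bar> \<le> 3 * int (b j)"
    and x0: "x 0 \<in> {0, 1}"
  shows "3 ^ d \<le> 3 ^ (\<Sum>j<d. b j) * \<bar>2 * x d - 3 ^ d\<bar>"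
    and "2 * (\<Sum>j\<le>d. x j) = 3 * x d - x 0 - (\<Sum>j<d. t j)"
proof -
  have "3 ^ i \<le> 3 ^ (\<Sum>j<i. b j) * \<bar>2 * x i - 3 ^ i\<bar>" if "i \<le> d" for i
    using that
  proof (induction i)
    case 0
    show ?case using x0 by auto
  next
    case (Suc i)
    let ?p = "3 ^ (\<Sum>j<i. b j) :: int"
    have "3 * \<bar>2 * x i - 3 ^ i\<bar> \<le> 3 ^ b i * \<bar>2 * x (Suc i) - 3 ^ Suc i\<bar>"
      using Suc.prems rec[of i] t[of i] by (intro odd_step[where t = "t i"]) simp_all
    then have "?p * (3 * \<bar>2 * x i - 3 ^ i\<bar>) \<le> ?p * (3 ^ b i * \<bar>2 * x (Suc i) - 3 ^ Suc i\<bar>)"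
      by (rule mult_left_mono) simp
    moreover have "?p * (3 ^ b i * \<bar>2 * x (Suc i) - 3 ^ Suc i\<bar>)
        = 3 ^ (\<Sum>j<Suc i. b j) * \<bar>2 * x (Suc i) - 3 ^ Suc i\<bar>"
      by (simp only: sum.lessThan_Suc power_add mult.assoc)
    moreover have "3 ^ i \<le> ?p * \<bar>2 * x i - 3 ^ i\<bar>"
      using Suc by simp
    ultimately show ?case
      by (simp only: power_Suc)
  qed
  then show "3 ^ d \<le> 3 ^ (\<Sum>j<d. b j) * \<bar>2 * x d - 3 ^ d\<bar>"
    by simp
  have "2 * (\<Sum>j\<le>i. x j) = 3 * x i - x 0 - (\<Sum>j<i. t j)" if "i \<le> d" for i
    using that
  proof (induction i)
    case (Suc i)
    then show ?case using rec[of i] by simp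
  qed simp
  then show "2 * (\<Sum>j\<le>d. x j) = 3 * x d - x 0 - (\<Sum>j<d. t j)"
    by simp
qed

text \<open>Half of the heap is \<open>(3 ^ Suc d - 1) / 4\<close>, so for \<open>W\<close> near
  that size the factor in parentheses is small and \<open>b\<close> must be of order
  \<open>d\<close>.\<close>

lemma isoperimetry:
  assumes W: "W \<subseteq> {..<heap_size (Suc d)}"
  defines "b \<equiv> card (boundary (heap_size (Suc d)) W)"
  shows "3 ^ Suc d \<le> 3 ^ b * (\<bar>4 * int (card W) - 3 ^ Suc d\<bar> + 10 * int b + 2)"
proof -
  let ?N = "heap_size (Suc d)"
  define X where "X j = {v \<in> W. lev v = j}" for j
  define Q where "Q j = {v. v \<notin> W \<and> lev v = j \<and> 0 < v \<and> par v \<in> W}" for j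
  define P where "P j = {v. v \<notin> W \<and> lev v = j \<and> (\<exists>u\<in>W. 0 < u \<and> par u = v)}" for j
  define R where "R j = {v \<in> W. lev v = j \<and> 0 < v \<and> par v \<notin> W}" for j
  define B where "B j = {v \<in> boundary ?N W. lev v = j}" for j
  \<comment> \<open>Level \<open>Suc j\<close> of \<open>x\<close> counts the children of
    \<open>X j\<close> together with \<open>R (Suc j)\<close>; replacing \<open>card (X j)\<close>
    by \<open>x j - card (Q j)\<close> produces \<open>t j\<close>. The parents of
    \<open>R (Suc j)\<close> form \<open>P j\<close>, which is also boundary.\<close>
  define x t where "x j = int (card (X j) + card (Q j))"
    and "t j = int (card (R (Suc j))) - 3 * int (card (Q j))" for j
  have fin: "finite (X j)" "finite (Q j)" "finite (P j)" "finite (R j)" "finite (B j)" for j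
    unfolding X_def Q_def P_def R_def B_def
    by (rule finite_subset[OF _ finite_level[of j]], force)+
  have QB: "card (Q j) \<le> card (B j)" if "j \<le> d" for j
  proof -
    have "Q j \<subseteq> B j"
      using that by (auto simp: Q_def B_def boundary_def adj_def less_heap_size_iff simp del: heap_size.simps)
    then show ?thesis using fin by (intro card_mono)
  qed
  have PB: "card (P j) \<le> card (B j)" if "j \<le> d" for j
  proof -
    have "P j \<subseteq> B j"
      using that by (auto simp: P_def B_def boundary_def adj_def less_heap_size_iff simp del: heap_size.simps)
    then show ?thesis using fin by (intro card_mono)
  qed
  have RP: "card (R (Suc j)) \<le> 3 * card (P j)" for j
  proof -
    have "R (Suc j) \<subseteq> children (P j)"
      by (auto simp: R_def P_def children_def lev_eq_Suc_iff)
    then have "card (R (Suc j)) \<le> card (children (P j))"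
      using fin finite_children by (intro card_mono) blast
    then show ?thesis using card_children fin by simp
  qed
  have rec: "x (Suc j) = 3 * x j + t j" for j
  proof -
    have "X (Suc j) \<union> Q (Suc j) = children (X j) \<union> R (Suc j)"
      by (auto simp: X_def Q_def R_def children_def lev_eq_Suc_iff)
    moreover have "X (Suc j) \<inter> Q (Suc j) = {}" "children (X j) \<inter> R (Suc j) = {}"
      by (auto simp: X_def Q_def R_def children_def)
    ultimately have "card (X (Suc j)) + card (Q (Suc j)) = card (children (X j)) + card (R (Suc j))"
      using fin finite_children by (metis card_Un_disjoint)
    then show ?thesis
      using card_children[OF fin(1)[of j]] by (simp add: x_def t_def)
  qed
  \<comment> \<open>\<open>t j\<close> is a difference of two terms, each between 0 and
    \<open>3 * card (B j)\<close>, hence the factor 3 rather than 6.\<close>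
  have t: "\<bar>t j\<bar> \<le> 3 * int (card (B j))" if "j < d" for j
    using QB[of j] PB[of j] RP[of j] that by (simp add: t_def)
  have x0: "x 0 \<in> {0, 1}"
  proof -
    have "Q 0 = {}" "X 0 \<subseteq> {0}"
      by (auto simp: Q_def X_def lev_eq_0_iff)
    then show ?thesis
      by (auto simp: x_def subset_singleton_iff)
  qed
  have b: "b = (\<Sum>j\<le>d. card (B j))"
    unfolding b_def B_def by (rule card_eq_sum_levels) (auto simp: boundary_def)
  define X' T where "X' = (\<Sum>j\<le>d. x j)" and "T = (\<Sum>j<d. t j)"
  have W_eq: "card W = (\<Sum>j\<le>d. card (X j))"
    unfolding X_def by (rule card_eq_sum_levels[OF W])
  have "(\<Sum>j\<le>d. card (Q j)) \<le> b"
    unfolding b by (intro sum_mono QB) simp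
  moreover have "X' = int (card W) + int (\<Sum>j\<le>d. card (Q j))"
    unfolding X'_def x_def W_eq by (simp add: sum.distrib)
  ultimately have X': "int (card W) \<le> X'" "X' \<le> int (card W) + int b"
    by linarith+
  have b_less: "(\<Sum>j<d. card (B j)) \<le> b"
    unfolding b by (intro sum_mono2) auto
  have "\<bar>T\<bar> \<le> (\<Sum>j<d. \<bar>t j\<bar>)"
    unfolding T_def by (rule sum_abs)
  also have "\<dots> \<le> (\<Sum>j<d. 3 * int (card (B j)))"
    using t by (intro sum_mono) simp
  also have "\<dots> \<le> 3 * int b"
    using b_less by (simp flip: sum_distrib_left of_nat_sum)
  finally have T: "\<bar>T\<bar> \<le> 3 * int b" .
  have X'_eq: "2 * X' = 3 * x d - x 0 - T"
    unfolding X'_def T_def using rec t x0 by (rule tripling_recurrence(2))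
  have e: "3 * \<bar>2 * x d - 3 ^ d\<bar> \<le> \<bar>4 * int (card W) - 3 ^ Suc d\<bar> + 10 * int b + 2"
  proof -
    have "\<bar>2 * x 0\<bar> \<le> 2"
      using x0 by auto
    moreover have "3 * (2 * x d - 3 ^ d) =
        (4 * int (card W) - 3 ^ Suc d) + 4 * (X' - int (card W)) + 2 * x 0 + 2 * T"
      using X'_eq by simp
    then have "3 * \<bar>2 * x d - 3 ^ d\<bar> =
        \<bar>(4 * int (card W) - 3 ^ Suc d) + 4 * (X' - int (card W)) + 2 * x 0 + 2 * T\<bar>"
      by (metis abs_mult abs_numeral)
    moreover have "\<bar>4 * (X' - int (card W))\<bar> \<le> 4 * int b" "\<bar>2 * T\<bar> \<le> 6 * int b"
      using X' T by simp_all
    moreover have "\<bar>p + q + r + s\<bar> \<le> \<bar>p\<bar> + \<bar>q\<bar> + \<bar>r\<bar> + \<bar>s\<bar>" for p q r s :: int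
      by linarith
    ultimately show ?thesis
      by (smt (verit))
  qed
  have "3 ^ d \<le> 3 ^ (\<Sum>j<d. card (B j)) * \<bar>2 * x d - 3 ^ d\<bar>"
    using rec t x0 by (rule tripling_recurrence(1))
  also have "\<dots> \<le> 3 ^ b * \<bar>2 * x d - 3 ^ d\<bar>"
    using b_less by (intro mult_right_mono power_increasing) auto
  finally have "3 ^ Suc d \<le> 3 ^ b * (3 * \<bar>2 * x d - 3 ^ d\<bar>)"
    by simp
  also have "\<dots> \<le> 3 ^ b * (\<bar>4 * int (card W) - 3 ^ Suc d\<bar> + 10 * int b + 2)"
    using e by (intro mult_left_mono) auto
  finally show ?thesis .
qed

section \<open>The mouse in the tree with leaves\<close>

lemma adj_parity: "adj x y \<Longrightarrow> even (lev y) \<longleftrightarrow> odd (lev x)"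
  unfolding adj_def using lev_par[of x] lev_par[of y] by (elim disjE conjE) simp_all

text \<open>State \<open>x\<close> in round \<open>t\<close> means that the mouse is at \<open>x\<close> if \<open>lev x + t\<close> is even, and at the leaf hung
  on \<open>x\<close> otherwise; \<open>K t\<close> is the set of states caught in round \<open>t\<close>.\<close>

primrec reach :: "nat \<Rightarrow> (nat \<Rightarrow> nat set) \<Rightarrow> nat \<Rightarrow> nat set" where
  "reach N K 0 = {..<N} - K 0"
| "reach N K (Suc t) =
     (reach N K t \<union> {y. y < N \<and> (\<exists>x\<in>reach N K t. even (lev x + t) \<and> adj x y)}) - K (Suc t)"

lemma reach_subset: "reach N K t \<subseteq> {..<N}"
  by (induction t) auto

text \<open>The set \<open>W\<close> mixes two consecutive rounds so that each half is taken when it is active.  A boundary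
  vertex of \<open>W\<close> is then entered in round \<open>Suc t\<close> or \<open>Suc (Suc t)\<close>, unless a cat prevents it.\<close>

lemma reach_growth:
  fixes N t :: nat and K :: "nat \<Rightarrow> nat set"
  assumes K: "\<And>t. finite (K t) \<and> card (K t) \<le> k"
  defines "W \<equiv> {x \<in> reach N K t. even (lev x + t)} \<union> {x \<in> reach N K (Suc t). odd (lev x + t)}"
  shows "card (reach N K (Suc t)) \<le> card W"
    and "card W \<le> card (reach N K (Suc t)) + k"
    and "card (boundary N W) + card (reach N K (Suc t)) \<le> card (reach N K (Suc (Suc t))) + 2 * k"
proof -
  have fin: "finite (reach N K t)" for t
    by (rule finite_subset[OF reach_subset]) simp
  have finW: "finite W"
    unfolding W_def using fin[of t] fin[of "Suc t"] by simp
  have card_Un_K: "card (S \<union> K t) \<le> card S + k" for S t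
    using card_Un_le[of S "K t"] K[of t] by linarith
  have sub: "reach N K (Suc t) \<subseteq> W"
  proof
    fix y assume y: "y \<in> reach N K (Suc t)"
    show "y \<in> W"
    proof (cases "even (lev y + t)")
      case True
      then have "\<not> (\<exists>x\<in>reach N K t. even (lev x + t) \<and> adj x y)"
        using adj_parity by (metis even_add)
      with y have "y \<in> reach N K t" unfolding reach.simps by blast
      with True show ?thesis by (simp add: W_def)
    next
      case False
      with y show ?thesis by (simp add: W_def del: reach.simps)
    qed
  qed
  then show "card (reach N K (Suc t)) \<le> card W"
    using finW by (rule card_mono[rotated])
  have "W \<subseteq> reach N K (Suc t) \<union> K (Suc t)"
    by (auto simp: W_def)
  then have "card W \<le> card (reach N K (Suc t) \<union> K (Suc t))"
    using fin[of "Suc t"] K by (intro card_mono) auto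
  with card_Un_K show "card W \<le> card (reach N K (Suc t)) + k"
    using le_trans by blast
  have "boundary N W \<subseteq> reach N K (Suc (Suc t)) \<union> K (Suc t) \<union> K (Suc (Suc t))"
  proof
    fix y assume "y \<in> boundary N W"
    then obtain u where y: "y < N" "y \<notin> W" and u: "u \<in> W" "adj u y"
      by (auto simp: boundary_def)
    show "y \<in> reach N K (Suc (Suc t)) \<union> K (Suc t) \<union> K (Suc (Suc t))"
    proof (cases "even (lev u + t)")
      case True
      then have "u \<in> reach N K t" "odd (lev y + t)"
        using u adj_parity[OF u(2)] by (auto simp: W_def)
      then have "y \<in> reach N K (Suc t) \<union> K (Suc t)"
        using True u(2) y(1) by auto
      moreover have "y \<notin> reach N K (Suc t)"
        using y(2) \<open>odd (lev y + t)\<close> by (auto simp: W_def)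
      ultimately show ?thesis by blast
    next
      case False
      then have "u \<in> reach N K (Suc t)"
        using u(1) by (auto simp: W_def)
      then show ?thesis
        using False u(2) y(1) unfolding reach.simps(2)[of N K "Suc t"] by auto
    qed
  qed
  moreover have "reach N K (Suc t) \<subseteq> reach N K (Suc (Suc t)) \<union> K (Suc (Suc t))"
    unfolding reach.simps(2)[of N K "Suc t"] by blast
  ultimately have "card (boundary N W \<union> reach N K (Suc t))
      \<le> card (reach N K (Suc (Suc t)) \<union> K (Suc t) \<union> K (Suc (Suc t)))"
    using fin[of "Suc (Suc t)"] K by (intro card_mono) auto
  also have "\<dots> \<le> card (reach N K (Suc (Suc t))) + k + k"
    using card_Un_K[of "reach N K (Suc (Suc t))" "Suc t"]
      card_Un_K[of "reach N K (Suc (Suc t)) \<union> K (Suc t)" "Suc (Suc t)"] by linarith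
  also have "card (boundary N W \<union> reach N K (Suc t)) = card (boundary N W) + card (reach N K (Suc t))"
  proof (rule card_Un_disjoint)
    show "finite (boundary N W)" by (simp add: boundary_def)
    show "finite (reach N K (Suc t))" by (rule fin)
    show "boundary N W \<inter> reach N K (Suc t) = {}"
      using sub by (auto simp: boundary_def)
  qed
  finally show "card (boundary N W) + card (reach N K (Suc t)) \<le> card (reach N K (Suc (Suc t))) + 2 * k"
    by simp
qed

text \<open>With at least \<open>m + k\<close> states, one round cannot drop below \<open>m\<close>.
  Otherwise \<open>W\<close> has size in the range of \<open>iso\<close>, and its
  \<open>2 * k\<close> boundary vertices make up for the catches of two rounds. Since
  \<open>W\<close> looks at rounds \<open>t\<close> and \<open>Suc t\<close>, the induction starts
  at round 1.\<close>

lemma reach_persists: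
  assumes K: "\<And>t. finite (K t) \<and> card (K t) \<le> k"
    and N: "m + 2 * k \<le> N"
    and iso: "\<And>W. W \<subseteq> {..<N} \<Longrightarrow> m \<le> card W \<Longrightarrow> card W < m + 2 * k \<Longrightarrow> 2 * k \<le> card (boundary N W)"
  shows "m \<le> card (reach N K t)"
proof -
  have fin: "finite (reach N K t)" for t
    by (rule finite_subset[OF reach_subset]) simp
  have loss: "card (reach N K t) \<le> card (reach N K (Suc t)) + k" for t
  proof -
    have "card (reach N K t) \<le> card (reach N K (Suc t) \<union> K (Suc t))"
      using fin[of "Suc t"] K by (intro card_mono) auto
    also have "\<dots> \<le> card (reach N K (Suc t)) + k"
      using card_Un_le[of "reach N K (Suc t)" "K (Suc t)"] K[of "Suc t"] by linarith
    finally show ?thesis .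
  qed
  have zero: "N \<le> card (reach N K 0) + k"
    using diff_card_le_card_Diff[of "K 0" "{..<N}"] K[of 0] unfolding reach.simps card_lessThan by linarith
  have "m \<le> card (reach N K (Suc t))" for t
  proof (induction t)
    case 0
    show ?case using zero loss[of 0] N by linarith
  next
    case (Suc t)
    define W where "W = {x \<in> reach N K t. even (lev x + t)} \<union> {x \<in> reach N K (Suc t). odd (lev x + t)}"
    note growth = reach_growth[where K = K and k = k and N = N and t = t, OF K, folded W_def]
    show ?case
    proof (cases "m + k \<le> card (reach N K (Suc t))")
      case True
      then show ?thesis using loss[of "Suc t"] by linarith
    next
      case False
      have "W \<subseteq> {..<N}"
        using reach_subset[of N K t] reach_subset[of N K "Suc t"] unfolding W_def by blast
      moreover have "m \<le> card W" "card W < m + 2 * k"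
        using growth(1,2) Suc.IH False by linarith+
      ultimately have "2 * k \<le> card (boundary N W)"
        by (rule iso)
      then show ?thesis using growth(3) Suc.IH by linarith
    qed
  qed
  with zero N show ?thesis by (cases t) auto
qed

text \<open>If \<open>b < 2 * k\<close>, the factor in \<open>isoperimetry\<close> is at most
  \<open>28 * k\<close>: the deviation from half gives \<open>8 * k\<close>, and
  \<open>10 * b + 2\<close> at most \<open>20 * k\<close>. Multiplying by 3 turns
  \<open>3 ^ b\<close> into at most \<open>9 ^ k\<close>.\<close>

lemma large_boundary:
  assumes k: "28 * k * 9 ^ k < 3 ^ (d + 2)"
    and W: "W \<subseteq> {..<heap_size (Suc d)}" "3 ^ Suc d div 4 \<le> card W" "card W < 3 ^ Suc d div 4 + 2 * k"
  shows "2 * k \<le> card (boundary (heap_size (Suc d)) W)"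
proof (rule ccontr)
  define b where "b = card (boundary (heap_size (Suc d)) W)"
  define p where "p = (3 :: nat) ^ Suc d"
  assume "\<not> ?thesis"
  then have b: "Suc b \<le> 2 * k" unfolding b_def by simp
  have "\<bar>4 * int (card W) - int p\<bar> \<le> 8 * int k"
    using W(2,3) b unfolding p_def[symmetric] by linarith
  then have "\<bar>4 * int (card W) - 3 ^ Suc d\<bar> + 10 * int b + 2 \<le> 28 * int k"
    using b by (simp add: p_def)
  then have "3 ^ b * (\<bar>4 * int (card W) - 3 ^ Suc d\<bar> + 10 * int b + 2) \<le> 3 ^ b * (28 * int k)"
    by (intro mult_left_mono) auto
  with isoperimetry[OF W(1)] have "3 ^ Suc d \<le> 3 ^ b * (28 * int k)"
    unfolding b_def by linarith
  moreover have "3 ^ (d + 2) = 3 * (3 ^ Suc d :: int)" "3 ^ Suc b * (28 * int k) = 3 * (3 ^ b * (28 * int k))"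
    by simp_all
  ultimately have "3 ^ (d + 2) \<le> 3 ^ Suc b * (28 * int k)"
    by linarith
  also have "\<dots> \<le> 3 ^ (2 * k) * (28 * int k)"
    using b by (intro mult_right_mono power_increasing) auto
  also have "\<dots> = int (28 * k * 9 ^ k)"
    by (simp add: power_mult)
  also have "\<dots> < int (3 ^ (d + 2))"
    using k by (simp only: of_nat_less_iff)
  finally show False by simp
qed

text \<open>The leaf hung on \<open>v < N\<close> is \<open>N + v\<close>; the vertices from \<open>2 * N\<close> on are further leaves on the root.\<close>

definition leafed_heap_parent :: "nat \<Rightarrow> nat \<Rightarrow> nat" where
  "leafed_heap_parent N v = (if v < N then par v else if v < 2 * N then v - N else 0)"

lemma not_cat_win_leafed_heap:
  assumes k: "0 < k" "28 * k * 9 ^ k < 3 ^ (d + 2)" and n: "2 * heap_size (Suc d) \<le> n"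
  shows "\<not> cat_win (parent_graph (leafed_heap_parent (heap_size (Suc d))) n) k"
proof
  define N where "N = heap_size (Suc d)"
  let ?G = "parent_graph (leafed_heap_parent N) n"
  define pos where "pos t x = (if even (lev x + t) then x else N + x)" for t x
  assume "cat_win (parent_graph (leafed_heap_parent (heap_size (Suc d))) n) k"
  then obtain C where C: "cat_strategy ?G k C" and no_evasion: "\<not> (\<exists>v. mouse_evades ?G C v)"
    unfolding cat_win_def N_def by blast
  define K where "K t = {x. x < N \<and> pos t x \<in> C t}" for t
  have K: "finite (K t) \<and> card (K t) \<le> k" for t
  proof -
    have C_t: "finite (C t)" "card (C t) \<le> k"
      using C by (auto simp: cat_strategy_def)
    have "inj_on (pos t) (K t)"
      by (auto simp: inj_on_def pos_def K_def split: if_splits)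
    moreover have "pos t ` K t \<subseteq> C t"
      by (auto simp: K_def)
    ultimately have "card (K t) \<le> card (C t)"
      using C_t(1) by (rule card_inj_on_le)
    with C_t(2) show ?thesis
      by (simp add: K_def)
  qed
  have N_eq: "2 * N + 1 = 3 ^ Suc d"
    unfolding N_def by (rule heap_size_eq)
  \<comment> \<open>A crude consequence of the exponential bound, \<open>252 = 28 * 9\<close>,
    leaves room for \<open>2 * k\<close> states above half and makes half positive.\<close>
  have "(9 :: nat) ^ 1 \<le> 9 ^ k"
    using k(1) by (intro power_increasing) auto
  then have "28 * k * 9 \<le> 28 * k * 9 ^ k"
    by (intro mult_le_mono2) simp
  also note k(2)
  also have "3 ^ (d + 2) = 3 * (2 * N + 1)"
    unfolding N_eq by simp
  finally have "252 * k < 6 * N + 3" by simp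
  then have m: "3 ^ Suc d div 4 + 2 * k \<le> N"
    unfolding N_eq[symmetric] using k(1) by linarith
  have nonempty: "reach N K t \<noteq> {}" for t
  proof -
    have "3 ^ Suc d div 4 \<le> card (reach N K t)"
      using K m by (rule reach_persists) (use large_boundary[OF k(2)] in \<open>simp add: N_def\<close>)
    moreover have "0 < (3 :: nat) ^ Suc d div 4"
      using \<open>252 * k < 6 * N + 3\<close> k(1) unfolding N_eq[symmetric] by linarith
    ultimately show ?thesis by auto
  qed
  have "\<exists>v. mouse_evades ?G C v"
  proof (rule mouse_evades_if_reachable_sets)
    show "finite (pverts ?G)" by simp
    show "pos t ` reach N K t \<noteq> {}" for t
      using nonempty by simp
    show "z \<in> pverts ?G \<and> z \<notin> C t" if z: "z \<in> pos t ` reach N K t" for t z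
    proof -
      obtain x where x: "x \<in> reach N K t" "z = pos t x"
        using z by blast
      then have "x < N" using reach_subset by blast
      moreover have "x \<notin> K t"
        using x by (cases t) auto
      ultimately show ?thesis
        using x n by (auto simp: K_def pos_def N_def)
    qed
    show "\<exists>w\<in>pos t ` reach N K t. (w, z) \<in> parcs ?G" if z: "z \<in> pos (Suc t) ` reach N K (Suc t)" for t z
    proof -
      obtain y where y: "y \<in> reach N K (Suc t)" "z = pos (Suc t) y"
        using z by blast
      then have "y < N" using reach_subset by blast
      consider "y \<in> reach N K t" | x where "x \<in> reach N K t" "even (lev x + t)" "adj x y"
        using y(1) by auto
      then show ?thesis
      proof cases
        case 1
        \<comment> \<open>Keeping the state \<open>y\<close> means crossing the pendant edge at
          \<open>y\<close>, since the parity flips with the round.\<close>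
        have "(pos t y, z) \<in> parcs ?G"
          using \<open>y < N\<close> n y(2) by (auto simp: pos_def leafed_heap_parent_def N_def)
        with 1 show ?thesis by blast
      next
        case 2
        then have "x < N" using reach_subset by blast
        have "even (lev y + Suc t)"
          using adj_parity[OF 2(3)] 2(2) by auto
        then have "pos t x = x" "z = y"
          using 2(2) y(2) by (auto simp: pos_def)
        moreover have "(x, y) \<in> parcs ?G"
          using \<open>x < N\<close> \<open>y < N\<close> n 2(3) by (auto simp: adj_def leafed_heap_parent_def N_def)
        ultimately show ?thesis using 2(1) by force
      qed
    qed
  qed
  with no_evasion show False by blast
qed

text \<open>Base 16 absorbs the factor \<open>28 * k\<close>, and \<open>log 2 16 = 4\<close> is the
  source of the constant 1/4.\<close>

lemma times_9_power_le_16_power: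
  assumes "10 \<le> k"
  shows "28 * k * 9 ^ k \<le> (16 :: nat) ^ k"
  using assms
proof (induction k rule: dec_induct)
  case (step k)
  have "28 * Suc k * 9 ^ Suc k = (28 * k * 9 ^ k) * 9 + 28 * 9 * 9 ^ k"
    by (simp add: algebra_simps)
  also have "\<dots> \<le> (28 * k * 9 ^ k) * 16"
  proof -
    have "28 * 9 * 9 ^ k \<le> (28 * k * 7) * 9 ^ k"
      using step by (intro mult_right_mono) auto
    then show ?thesis by (simp add: algebra_simps)
  qed
  also have "\<dots> \<le> 16 ^ Suc k"
    using step by simp
  finally show ?case .
qed simp

theorem theorem1p5:
  fixes \<epsilon> :: real
  assumes "\<epsilon> > 0"
  shows "\<exists>n0::nat. \<forall>n\<ge>n0. \<exists>T :: nat pair_pre_digraph.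
           undirected_tree T \<and> card (pverts T) = n \<and>
           real (cat_number T) \<ge> (1/4 - \<epsilon>) * log 2 (real n)"
proof (rule exI, intro allI impI)
  fix n :: nat
  assume n: "(16 :: nat) ^ 10 \<le> n"
  then have n1: "1 \<le> n" by simp
  \<comment> \<open>\<open>k\<close> is the integer part of the base-16 logarithm of
    \<open>n\<close>, and \<open>e\<close> the largest number of levels for which the heap with its
    leaves fits into \<open>n\<close> vertices. Hence \<open>16 ^ k\<close> is below
    \<open>3 ^ (e + 1) = 3 ^ (d + 2)\<close>.\<close>
  obtain k where k: "(16 :: nat) ^ k \<le> n" "n < 16 ^ (k + 1)"
    using ex_power_ivl1[of 16 n] n1 by auto
  obtain e where e: "(3 :: nat) ^ e \<le> n + 1" "n + 1 < 3 ^ (e + 1)"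
    using ex_power_ivl1[of 3 "n + 1"] by auto
  have "(16 :: nat) ^ 10 < 16 ^ (k + 1)"
    using n k by linarith
  then have "10 < k + 1"
    by (rule power_less_imp_less_exp[rotated]) simp
  then have k10: "10 \<le> k" by simp
  have "e \<noteq> 0"
    using e(2) n by (intro notI) simp
  then obtain d where d: "e = Suc d" by (cases e) auto
  define p where "p = leafed_heap_parent (heap_size (Suc d))"
  have n_heap: "2 * heap_size (Suc d) \<le> n"
    using heap_size_eq[of "Suc d"] e(1) unfolding d by linarith
  have "28 * k * 9 ^ k < 3 ^ (d + 2)"
    using times_9_power_le_16_power[OF k10] k(1) e(2) d by simp
  then have "\<not> cat_win (parent_graph p n) k"
    unfolding p_def using k10 n_heap by (intro not_cat_win_leafed_heap) auto
  then have "k < cat_number (parent_graph p n)"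
    by (intro less_cat_number) auto
  then have "real k + 1 \<le> real (cat_number (parent_graph p n))"
    by linarith
  moreover have "log 2 (real n) \<le> 4 * (real k + 1)"
  proof -
    have "real n \<le> 16 ^ (k + 1)"
      using k(2) by (metis less_imp_le of_nat_le_iff of_nat_numeral of_nat_power)
    also have "\<dots> = 2 ^ (4 * (k + 1))"
      by (simp only: power_mult) simp
    finally have "log 2 (real n) \<le> log 2 (2 ^ (4 * (k + 1)))"
      using n1 by (intro log_mono) auto
    also have "\<dots> = real (4 * (k + 1))"
      by (rule log_pow_cancel) auto
    finally show ?thesis by simp
  qed
  ultimately have "1/4 * log 2 (real n) \<le> real (cat_number (parent_graph p n))"
    by argo
  moreover have "(1/4 - \<epsilon>) * log 2 (real n) \<le> 1/4 * log 2 (real n)"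
    using assms n1 by (intro mult_right_mono) auto
  ultimately have "(1/4 - \<epsilon>) * log 2 (real n) \<le> real (cat_number (parent_graph p n))"
    by (rule order_trans[rotated])
  moreover have "undirected_tree (parent_graph p n)"
  proof (rule undirected_tree_parent_graph)
    show "0 < n" using n1 by simp
    show "p v < v" if "0 < v" "v < n" for v
      using that par_less[of v] by (auto simp: p_def leafed_heap_parent_def simp del: heap_size.simps)
  qed
  ultimately show "\<exists>T :: nat pair_pre_digraph. undirected_tree T \<and> card (pverts T) = n \<and>
      real (cat_number T) \<ge> (1/4 - \<epsilon>) * log 2 (real n)"
    by (intro exI[of _ "parent_graph p n"]) simp
qed

end
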